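(* Let $G$ be an infinite finitely generated group and $S$ a finite generating set of $G$. Then $h(X_{G,S})=\log(\mu(G,S))$, where $h(X_{G,S})$ is the topological entropy of the skeleton $X_{G,S}$ and $\mu(G,S)$ is the connective constant of the Cayley graph $\Gamma(G,S)$.
   Context: All generating sets $S$ are finite, symmetric ($S=S^{-1}$) and do not contain the identity $1_G$. For $w\in S^*$, $\overline{w}\in G$ is the element represented by $w$; a factor is a finite contiguous subword. The skeleton is $X_{G,S}=\{x\in S^{\mathbb{Z}} : \overline{w}\neq 1_G \text{ for every nonempty finite factor } w \text{ of } x\}$. For a subshift $X$, $p_X(n)$ is the number of words of length $n$ that are factors of some $x\in X$, and $h(X)=\lim_{n\to\infty}\frac1n\log p_X(n)$. The Cayley graph $\Gamma(G,S)$ has vertex set $G$ and edges between $g$ and $gs$ ($g\in G,s\in S$). The connective constant is $\mu(G,S)=\lim_{n\to\infty}\sqrt[n]{c_n}$, where $c_n$ is the number of self-avoiding walks (paths never visiting a vertex twice) of length $n$ in $\Gamma(G,S)$ starting at $1_G$. *)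

theory Defs
  imports
    "HOL-Analysis.Analysis"
    "HOL-Algebra.Generated_Groups"
    "Graph_Theory.Vertex_Walk"
begin

section \<open>Factors, complexity and entropy\<close>

text \<open>Bi-infinite words are functions on the integers.\<close>

definition factor :: "'a list \<Rightarrow> (int \<Rightarrow> 'a) \<Rightarrow> bool" where
  "factor w x \<longleftrightarrow> (\<exists>i. w = map (\<lambda>k. x (i + int k)) [0..<length w])"

definition complexity :: "(int \<Rightarrow> 'a) set \<Rightarrow> nat \<Rightarrow> nat" where
  "complexity X n = card {w. length w = n \<and> (\<exists>x\<in>X. factor w x)}"

text \<open>
  The limit exists, by Fekete's lemma, whenever \<open>X\<close> is nonempty and shift-invariant over a finite
  alphabet. The empty subshift, whose entropy is by convention minus infinity, gets the
  junk value \<open>0\<close>.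
\<close>

definition entropy :: "(int \<Rightarrow> 'a) set \<Rightarrow> real" where
  "entropy X = lim (\<lambda>n. ln (real (complexity X n)) / real n)"

section \<open>The skeleton\<close>

definition word_value :: "('a, 'b) monoid_scheme \<Rightarrow> 'a list \<Rightarrow> 'a" where
  "word_value G w = foldr (mult G) w (one G)"

definition skeleton :: "('a, 'b) monoid_scheme \<Rightarrow> 'a set \<Rightarrow> (int \<Rightarrow> 'a) set" where
  "skeleton G S = {x. (\<forall>i. x i \<in> S) \<and>
     (\<forall>w. factor w x \<and> w \<noteq> [] \<longrightarrow> word_value G w \<noteq> one G)}"

section \<open>Cayley graph and connective constant\<close>

text \<open>
  An undirected edge is represented by its two orientations, so the digraph below is symmetric
  when \<open>S\<close> is. There are no parallel arcs: a walk is determined by its list of vertices.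
\<close>

definition cayley_graph :: "('a, 'b) monoid_scheme \<Rightarrow> 'a set \<Rightarrow> ('a, 'a \<times> 'a) pre_digraph" where
  "cayley_graph G S =
     \<lparr>verts = carrier G,
      arcs = {(g, mult G g s) | g s. g \<in> carrier G \<and> s \<in> S},
      tail = fst, head = snd\<rparr>"

text \<open>The length of a walk is its number of edges, one less than the length of the vertex list.\<close>

definition saw_count :: "('a, 'b) pre_digraph \<Rightarrow> 'a \<Rightarrow> nat \<Rightarrow> nat" where
  "saw_count \<Gamma> v n = card {p. vpath p \<Gamma> \<and> hd p = v \<and> vwalk_length p = n}"

definition connective_constant :: "('a, 'b) monoid_scheme \<Rightarrow> 'a set \<Rightarrow> real" where
  "connective_constant G S =
     lim (\<lambda>n. root n (real (saw_count (cayley_graph G S) (one G) n)))"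

end

theory Submission
  imports Defs "HOL-Library.Sublist"
begin

text \<open>
  Self-avoiding walks from the identity correspond to the words without nonempty trivial factors;
  these words form a factorial language and the skeleton is the subshift of all bi-infinite words
  with factors in it. For any factorial language with \<open>c n\<close> words of length \<open>n\<close>, compactness
  gives, for each \<open>n\<close>, some \<open>k\<close> such that every word of length \<open>n\<close> that extends by \<open>k\<close> letters
  on both sides within the language is a factor of the subshift \<open>X\<close>. Cutting the middle part of a
  word into blocks of length \<open>n\<close> yields
  \<open>c (m * n + 2 * k) \<le> (card A) ^ (2 * k) * (complexity X n) ^ m\<close>. Letting \<open>m\<close> tend to infinity,
  the exponential growth rate of \<open>c\<close>, which exists by Fekete's lemma and is an infimum, is at most
  \<open>ln (complexity X n) / n \<le> ln (c n) / n\<close>, so both sides converge to it.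
\<close>

section \<open>Fekete's lemma\<close>

lemma subadditive_mult_le:
  fixes a :: "nat \<Rightarrow> real"
  assumes sub: "\<And>m n. a (m + n) \<le> a m + a n"
  shows "a (q * n + r) \<le> real q * a n + a r"
proof (induction q)
  case (Suc q)
  have "a (Suc q * n + r) = a (n + (q * n + r))" by (simp add: algebra_simps)
  also have "\<dots> \<le> a n + a (q * n + r)" by (rule sub)
  finally show ?case using Suc.IH by (simp add: algebra_simps)
qed simp

text \<open>Nonnegativity makes the infimum of \<open>a n / real n\<close> over
  \<open>n \<ge> 1\<close> finite, and that infimum is the limit. The bound is stated in multiplied
  form so that it also covers \<open>n = 0\<close>.\<close>

lemma fekete_nonneg:
  fixes a :: "nat \<Rightarrow> real"
  assumes sub: "\<And>m n. a (m + n) \<le> a m + a n"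
    and nonneg: "\<And>n. 0 \<le> a n"
  obtains l where "(\<lambda>n. a n / real n) \<longlonglongrightarrow> l" and "\<And>n. l * real n \<le> a n" and "0 \<le> l"
proof -
  define l where "l = (INF n\<in>{1..}. a n / real n)"
  have bdd: "bdd_below ((\<lambda>n. a n / real n) ` {1..})"
    by (rule bdd_belowI[of _ 0]) (auto simp: nonneg)
  have le: "l \<le> a n / real n" if "n \<ge> 1" for n
    unfolding l_def using that by (intro cINF_lower bdd) auto
  have "0 \<le> l"
    unfolding l_def by (rule cINF_greatest) (auto simp: nonneg)
  have "l * real n \<le> a n" for n
    using le[of n] nonneg[of n] by (cases "n = 0") (auto simp: field_simps)
  moreover have "(\<lambda>n. a n / real n) \<longlonglongrightarrow> l"
  proof (rule LIMSEQ_I)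
    fix e :: real assume "e > 0"
    then have "l < l + e / 2" by simp
    then obtain N where N: "N \<ge> 1" "a N / real N < l + e / 2"
      unfolding l_def using cINF_less_iff[OF _ bdd, of "l + e / 2"] by (auto simp: l_def)
    \<comment> \<open>\<open>C\<close> bounds the term \<open>a (n mod N)\<close> uniformly in
      \<open>n\<close>; \<open>M\<close> is then chosen so that \<open>C / real n\<close> drops
      below \<open>e / 2\<close>.\<close>
    define C where "C = Max (a ` {..<N})"
    have C: "a r \<le> C" if "r < N" for r
      unfolding C_def using that by (intro Max_ge) auto
    have "C \<ge> 0" using C[of 0] nonneg[of 0] N by simp
    obtain M :: nat where M: "real M > 2 * C / e" "M \<ge> 1"
      by (metis le_add2 less_add_same_cancel1 reals_Archimedean2 less_trans of_nat_add
          of_nat_1 zero_less_one)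
    have "norm (a n / real n - l) < e" if "n \<ge> M" for n
    proof -
      have n: "real n > 0" "real n > 2 * C / e" using that M by linarith+
      have "a n \<le> real (n div N) * a N + a (n mod N)"
        using subadditive_mult_le[of a "n div N" N "n mod N", OF sub] by simp
      also have "\<dots> \<le> real (n div N) * a N + C" using C N by simp
      also have "real (n div N) * a N \<le> (real n / real N) * a N"
        by (intro mult_right_mono nonneg) (use of_nat_div_le_of_nat[of n N] in simp)
      finally have "a n / real n \<le> a N / real N + C / real n"
        using n N by (simp add: field_simps)
      also have "C / real n < e / 2" using n \<open>e > 0\<close> by (simp add: field_simps)
      finally have "a n / real n < l + e" using N by simp
      moreover have "l \<le> a n / real n" using le that M by simp
      ultimately show ?thesis by simp
    qed
    then show "\<exists>M. \<forall>n\<ge>M. norm (a n / real n - l) < e" by blast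
  qed
  ultimately show ?thesis using that \<open>0 \<le> l\<close> by blast
qed

section \<open>Entropy of factorial languages\<close>

locale factorial_language =
  fixes A :: "'a set" and L :: "'a list set"
  assumes finite_alphabet: "finite A"
    and over_alphabet: "L \<subseteq> lists A"
    and sublist_closed: "w \<in> L \<Longrightarrow> sublist u w \<Longrightarrow> u \<in> L"
    and all_lengths: "\<exists>w\<in>L. length w = n"
begin

text \<open>These sets interpolate between the words of \<open>L\<close> (depth 0) and the factors
  of \<open>subshift\<close>: for fixed \<open>n\<close> they decrease in \<open>k\<close>, and
  their intersection is the set of factors of length \<open>n\<close>.\<close>

definition extendable :: "nat \<Rightarrow> nat \<Rightarrow> 'a list set" where
  "extendable k n = {w. length w = n \<and> (\<exists>u v. length u = k \<and> length v = k \<and> u @ w @ v \<in> L)}"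

definition subshift :: "(int \<Rightarrow> 'a) set" where
  "subshift = {x. \<forall>w. factor w x \<longrightarrow> w \<in> L}"

section \<open>Counting extendable words\<close>

lemma extendableI:
  assumes "length w = n" "length u = k" "length v = k" "u @ w @ v \<in> L"
  shows "w \<in> extendable k n"
  using assms by (auto simp: extendable_def)

lemma extendable_0: "extendable 0 n = {w \<in> L. length w = n}"
  by (auto simp: extendable_def)

lemma extendable_subset: "extendable k n \<subseteq> {w \<in> L. length w = n}"
  by (auto simp: extendable_def intro: sublist_closed)

lemma finite_words: "finite {w \<in> L. length w = n}"
  by (rule finite_subset[OF _ finite_lists_length_eq[OF finite_alphabet, of n]])
    (use over_alphabet in auto)

lemma finite_extendable: "finite (extendable k n)"
  using finite_subset[OF extendable_subset finite_words] .

lemma extendable_antimono: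
  assumes "j \<le> k" shows "extendable k n \<subseteq> extendable j n"
proof
  fix w assume "w \<in> extendable k n"
  then obtain u v where uv: "length w = n" "length u = k" "length v = k" "u @ w @ v \<in> L"
    by (auto simp: extendable_def)
  have "u @ w @ v = take (k - j) u @ (drop (k - j) u @ w @ take j v) @ drop j v"
    by (metis append.assoc append_take_drop_id)
  then have "drop (k - j) u @ w @ take j v \<in> L"
    using uv(4) by (metis sublist_appendI sublist_closed)
  with uv assms show "w \<in> extendable j n"
    by (intro extendableI[of _ _ "drop (k - j) u" _ "take j v"]) auto
qed

lemma extendable_nonempty: "extendable k n \<noteq> {}"
proof -
  obtain w where w: "w \<in> L" "length w = k + n + k" using all_lengths by blast
  have "w = take k w @ take n (drop k w) @ drop n (drop k w)" by (simp only: append_take_drop_id)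
  then have "take n (drop k w) \<in> extendable k n"
    using w by (intro extendableI[of _ _ "take k w" _ "drop n (drop k w)"]) auto
  then show ?thesis by blast
qed

lemma card_extendable_pos: "card (extendable k n) > 0"
  using extendable_nonempty finite_extendable by (simp add: card_gt_0_iff)

text \<open>Cutting a word loses no depth: the right context of the first half is taken from the
  start of \<open>y @ v\<close>, the left context of the second half from the end of
  \<open>u @ x\<close>, and both are long enough to supply \<open>k\<close> letters.\<close>

lemma card_extendable_add_le:
  "card (extendable k (m + n)) \<le> card (extendable k m) * card (extendable k n)"
proof -
  have "extendable k (m + n) \<subseteq> (\<lambda>(u, v). u @ v) ` (extendable k m \<times> extendable k n)"
  proof
    fix w assume "w \<in> extendable k (m + n)"
    then obtain u v where uv: "length w = m + n" "length u = k" "length v = k" "u @ w @ v \<in> L"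
      by (auto simp: extendable_def)
    define x y where "x = take m w" and "y = drop m w"
    have w: "w = x @ y" "length x = m" "length y = n" using uv(1) by (auto simp: x_def y_def)
    have "u @ w @ v = (u @ x @ take k (y @ v)) @ drop k (y @ v)"
      unfolding w by (metis append.assoc append_take_drop_id)
    then have "u @ x @ take k (y @ v) \<in> L"
      using uv(4) by (metis sublist_append_rightI sublist_closed)
    then have "x \<in> extendable k m"
      using w uv by (intro extendableI[of _ _ u _ "take k (y @ v)"]) auto
    moreover have "u @ w @ v = take m (u @ x) @ (drop m (u @ x) @ y @ v)"
      unfolding w by (metis append.assoc append_take_drop_id)
    then have "drop m (u @ x) @ y @ v \<in> L"
      using uv(4) by (metis sublist_append_leftI sublist_closed)
    then have "y \<in> extendable k n"
      using w uv by (intro extendableI[of _ _ "drop m (u @ x)" _ v]) auto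
    ultimately show "w \<in> (\<lambda>(u, v). u @ v) ` (extendable k m \<times> extendable k n)"
      using w by force
  qed
  then have "card (extendable k (m + n)) \<le> card (extendable k m \<times> extendable k n)"
    by (intro surj_card_le finite_cartesian_product finite_extendable)
  then show ?thesis by (simp add: card_cartesian_product)
qed

text \<open>The two borders of length \<open>k\<close> are arbitrary words over \<open>A\<close>, so
  passing to extendable words costs only a factor that does not depend on \<open>n\<close>.\<close>

lemma card_words_le:
  "card {w \<in> L. length w = k + n + k} \<le> card A ^ k * card (extendable k n) * card A ^ k"
proof -
  let ?B = "{w. set w \<subseteq> A \<and> length w = k}"
  have fin: "finite ?B" using finite_lists_length_eq[OF finite_alphabet] .
  have "{w \<in> L. length w = k + n + k} \<subseteq> (\<lambda>(u, w, v). u @ w @ v) ` (?B \<times> extendable k n \<times> ?B)"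
  proof
    fix z assume z: "z \<in> {w \<in> L. length w = k + n + k}"
    define u w v where "u = take k z" and "w = take n (drop k z)" and "v = drop n (drop k z)"
    have eq: "z = u @ w @ v" by (simp only: u_def v_def w_def append_take_drop_id)
    have len: "length u = k" "length w = n" "length v = k" using z by (auto simp: u_def v_def w_def)
    have "set u \<subseteq> A" "set v \<subseteq> A" using z eq over_alphabet by auto
    moreover have "w \<in> extendable k n" using z eq len by (auto simp: extendable_def)
    ultimately show "z \<in> (\<lambda>(u, w, v). u @ w @ v) ` (?B \<times> extendable k n \<times> ?B)"
      using eq len by (intro image_eqI[of _ _ "(u, w, v)"]) auto
  qed
  then have "card {w \<in> L. length w = k + n + k} \<le> card (?B \<times> extendable k n \<times> ?B)"
    by (intro surj_card_le finite_cartesian_product finite_extendable fin)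
  then show ?thesis
    by (simp add: card_cartesian_product card_lists_length_eq finite_alphabet algebra_simps)
qed

section \<open>Compactness: from extendable words to bi-infinite words\<close>

lemma extend_step:
  assumes "\<forall>k. w \<in> extendable k (length w)"
  shows "\<exists>a b. \<forall>k. a # w @ [b] \<in> extendable k (length w + 2)"
proof (rule ccontr)
  assume "\<not> ?thesis"
  then obtain K where K: "\<And>a b. a # w @ [b] \<notin> extendable (K a b) (length w + 2)" by metis
  \<comment> \<open>As \<open>A\<close> is finite, the failure depths have a common bound
    \<open>M\<close>, and failure persists at larger depth. Contexts of length \<open>Suc M\<close>
    then give a contradiction: their inner letters \<open>a\<close> and \<open>b\<close> join the
    word, and contexts of length \<open>M\<close> remain.\<close>
  define M where "M = Max ((\<lambda>(a, b). K a b) ` (A \<times> A))"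
  have M: "K a b \<le> M" if "a \<in> A" "b \<in> A" for a b
    unfolding M_def using that finite_alphabet by (intro Max_ge) force+
  from assms obtain u v where uv: "length u = Suc M" "length v = Suc M" "u @ w @ v \<in> L"
    unfolding extendable_def by blast
  obtain u' a where u: "u = u' @ [a]" using uv(1) by (cases u rule: rev_cases) auto
  obtain b v' where v: "v = b # v'" using uv(2) by (cases v) auto
  have "a \<in> A" "b \<in> A" using uv(3) over_alphabet u v by auto
  moreover have "a # w @ [b] \<in> extendable M (length w + 2)"
    using uv u v by (intro extendableI[of _ _ u' _ v']) auto
  ultimately show False using K M extendable_antimono by blast
qed

text \<open>Place \<open>W j\<close> on the positions from \<open>-j\<close> up to, but excluding,
  \<open>length (W 0) + j\<close>. Successive words agree where they overlap, so they glue to a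
  bi-infinite word, and each finite window of it lies inside some \<open>W j\<close>.\<close>

lemma nested_words_limit:
  fixes W :: "nat \<Rightarrow> 'a list"
  assumes step: "\<And>j. \<exists>a b. W (Suc j) = a # W j @ [b]"
    and in_L: "\<And>j. W j \<in> L"
  shows "\<exists>x\<in>subshift. factor (W 0) x"
proof -
  have len: "length (W j) = length (W 0) + 2 * j" for j
  proof (induction j)
    case (Suc j) then show ?case using step[of j] by auto
  qed simp
  have nth_Suc: "W (Suc j) ! Suc p = W j ! p" if "p < length (W j)" for j p
    using step[of j] that by (auto simp: nth_append)
  have nth_add: "W (j + d) ! (p + d) = W j ! p" if "p < length (W j)" for j d p
  proof (induction d)
    case (Suc d)
    have "p + d < length (W (j + d))" using that len[of j] len[of "j + d"] by simp
    then show ?case using nth_Suc[of "p + d" "j + d"] Suc by simp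
  qed simp
  \<comment> \<open>\<open>N i\<close> is a stage whose window contains position \<open>i\<close>;
    the \<open>+ 1\<close> is needed for nonnegative \<open>i\<close> when \<open>W 0\<close> is
    empty. The next facts show that every other stage containing \<open>i\<close> gives the same
    letter.\<close>
  define N where "N i = nat \<bar>i\<bar> + 1" for i :: int
  define x where "x i = W (N i) ! nat (i + int (N i))" for i
  have x: "x i = W j ! nat (i + int j)"
    if "- int j \<le> i" "i < int (length (W 0)) + int j" for i j
  proof (cases "j \<le> N i")
    case True
    have "nat (i + int (N i)) = nat (i + int j) + (N i - j)" using that True by linarith
    moreover have "nat (i + int j) < length (W j)" using that len[of j] by linarith
    ultimately show ?thesis
      using nth_add[of "nat (i + int j)" j "N i - j"] True by (simp add: x_def)
  next
    case False
    have "nat (i + int j) = nat (i + int (N i)) + (j - N i)"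
      using False by (auto simp: N_def)
    moreover have "nat (i + int (N i)) < length (W (N i))"
      using len[of "N i"] by (auto simp: N_def)
    ultimately show ?thesis
      using nth_add[of "nat (i + int (N i))" "N i" "j - N i"] False by (simp add: x_def)
  qed
  have "x \<in> subshift"
    unfolding subshift_def
  proof (intro CollectI allI impI)
    fix w assume "factor w x"
    then obtain i where i: "w = map (\<lambda>k. x (i + int k)) [0..<length w]"
      by (auto simp: factor_def)
    \<comment> \<open>This stage is large enough to contain all positions from \<open>i\<close> to
      \<open>i + length w - 1\<close>.\<close>
    define j where "j = nat \<bar>i\<bar> + length w"
    have "w = take (length w) (drop (nat (i + int j)) (W j))"
    proof (rule nth_equalityI)
      show l: "length w = length (take (length w) (drop (nat (i + int j)) (W j)))"
        using len[of j] unfolding j_def by simp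
      fix p assume p: "p < length w"
      then have "w ! p = x (i + int p)" by (subst i) simp
      also have "\<dots> = W j ! nat (i + int p + int j)"
        using p by (intro x) (auto simp: j_def)
      also have "nat (i + int p + int j) = nat (i + int j) + p"
        by (auto simp: j_def)
      finally show "w ! p = take (length w) (drop (nat (i + int j)) (W j)) ! p"
        using p l by (simp add: min_def split: if_splits)
    qed
    then have "sublist w (W j)"
      by (metis sublist_drop sublist_order.order.trans sublist_take)
    then show "w \<in> L" using in_L sublist_closed by blast
  qed
  moreover have "factor (W 0) x"
    unfolding factor_def by (rule exI[of _ 0]) (auto simp: x[of 0] intro!: nth_equalityI)
  ultimately show ?thesis by blast
qed

text \<open>A Koenig-type argument: extendability to every depth is an invariant that
  \<open>extend_step\<close> preserves, so dependent choice yields nested words growing by one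
  letter on each side.\<close>

lemma extendable_imp_factor:
  assumes "\<forall>k. w \<in> extendable k (length w)"
  shows "\<exists>x\<in>subshift. factor w x"
proof -
  let ?P = "\<lambda>j v. (\<forall>k. v \<in> extendable k (length v)) \<and> (j = (0::nat) \<longrightarrow> v = w)"
  have "\<exists>W. \<forall>j. ?P j (W j) \<and> (\<exists>a b. W (Suc j) = a # W j @ [b])"
  proof (rule dependent_nat_choice)
    show "\<exists>v. ?P 0 v" using assms by blast
    fix v and j :: nat assume "?P j v"
    then obtain a b where "\<forall>k. a # v @ [b] \<in> extendable k (length v + 2)"
      using extend_step by blast
    then show "\<exists>y. ?P (Suc j) y \<and> (\<exists>a b. y = a # v @ [b])"
      by (intro exI[of _ "a # v @ [b]"]) auto
  qed
  then obtain W where W: "\<And>j. ?P j (W j)" "\<And>j. \<exists>a b. W (Suc j) = a # W j @ [b]" by blast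
  have "W j \<in> L" for j using W(1)[of j] extendable_subset by blast
  with W(2) nested_words_limit[of W] show ?thesis using W(1)[of 0] by auto
qed

text \<open>Each of the finitely many words of length \<open>n\<close> that are not factors fails at
  some depth, and the largest of these depths excludes all of them at once.\<close>

lemma exists_extendable_subset_factors:
  "\<exists>k. extendable k n \<subseteq> {w. length w = n \<and> (\<exists>x\<in>subshift. factor w x)}"
proof -
  let ?F = "{w. length w = n \<and> (\<exists>x\<in>subshift. factor w x)}"
  let ?B = "{w \<in> L. length w = n} - ?F"
  have "\<exists>k. w \<notin> extendable k n" if "w \<in> ?B" for w
    using that extendable_imp_factor[of w] by auto
  then have "\<exists>K. \<forall>w\<in>?B. w \<notin> extendable (K w) n" by (intro bchoice) blast
  then obtain K where K: "\<And>w. w \<in> ?B \<Longrightarrow> w \<notin> extendable (K w) n" by blast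
  have fin: "finite (K ` ?B)" using finite_words by simp
  \<comment> \<open>If \<open>?B\<close> is empty, \<open>Max\<close> has an unspecified value,
    which is harmless because every word of length \<open>n\<close> in \<open>L\<close> is then a
    factor.\<close>
  have "extendable (Max (K ` ?B)) n \<subseteq> ?F"
  proof
    fix w assume w: "w \<in> extendable (Max (K ` ?B)) n"
    show "w \<in> ?F"
    proof (rule ccontr)
      assume "w \<notin> ?F"
      with w have "w \<in> ?B" using extendable_subset by blast
      then show False using K w extendable_antimono Max_ge[OF fin] by blast
    qed
  qed
  then show ?thesis by blast
qed

section \<open>The entropy as the growth rate of the language\<close>

lemma complexity_subshift_le: "complexity subshift n \<le> card {w \<in> L. length w = n}"
  unfolding complexity_def
  by (rule card_mono[OF finite_words]) (auto simp: subshift_def)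

lemma finite_factors: "finite {w. length w = n \<and> (\<exists>x\<in>subshift. factor w x)}"
  by (rule finite_subset[OF _ finite_words[of n]]) (auto simp: subshift_def)

theorem entropy_subshift:
  obtains l where "(\<lambda>n. ln (real (card {w \<in> L. length w = n})) / real n) \<longlonglongrightarrow> l"
    and "entropy subshift = l"
proof -
  define a where "a n = ln (real (card {w \<in> L. length w = n}))" for n
  have pos: "card {w \<in> L. length w = n} > 0" for n
    using card_extendable_pos[of 0 n] by (simp add: extendable_0)
  have sub: "a (m + n) \<le> a m + a n" for m n
  proof -
    have "a (m + n) \<le> ln (real (card {w \<in> L. length w = m} * card {w \<in> L. length w = n}))"
      unfolding a_def using card_extendable_add_le[of 0 m n] pos[of "m + n"]
      by (simp only: extendable_0 ln_le_cancel_iff of_nat_0_less_iff of_nat_le_iff)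
    also have "\<dots> = a m + a n" unfolding a_def using pos by (simp add: ln_mult)
    finally show ?thesis .
  qed
  have nonneg: "0 \<le> a n" for n unfolding a_def using pos[of n] by simp
  obtain l where l: "(\<lambda>n. a n / real n) \<longlonglongrightarrow> l" "\<And>n. l * real n \<le> a n" "0 \<le> l"
    using fekete_nonneg[of a, OF sub nonneg] by blast
  have lower: "l * real n \<le> ln (real (complexity subshift n))" for n
  proof -
    obtain k where k: "extendable k n \<subseteq> {w. length w = n \<and> (\<exists>x\<in>subshift. factor w x)}"
      using exists_extendable_subset_factors by blast
    define p where "p n = ln (real (card (extendable k n)))" for n
    have psub: "p (m + n) \<le> p m + p n" for m n
    proof -
      have "p (m + n) \<le> ln (real (card (extendable k m) * card (extendable k n)))"
        unfolding p_def using card_extendable_add_le[of k m n] card_extendable_pos[of k "m + n"]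
        by (simp only: ln_le_cancel_iff of_nat_0_less_iff of_nat_le_iff)
      also have "\<dots> = p m + p n"
        unfolding p_def using card_extendable_pos by (simp add: ln_mult)
      finally show ?thesis .
    qed
    have "card A > 0"
    proof -
      obtain w where "w \<in> L" "length w = 1" using all_lengths by blast
      then have "A \<noteq> {}" using over_alphabet by (cases w) auto
      then show ?thesis using finite_alphabet by (simp add: card_gt_0_iff)
    qed
    have a_le: "a (k + N + k) \<le> 2 * real k * ln (real (card A)) + p N" for N
    proof -
      have "a (k + N + k) \<le> ln (real (card A ^ k * card (extendable k N) * card A ^ k))"
        unfolding a_def using card_words_le[of k N] pos[of "k + N + k"]
        by (simp only: ln_le_cancel_iff of_nat_0_less_iff of_nat_le_iff)
      also have "\<dots> = 2 * real k * ln (real (card A)) + p N"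
        unfolding p_def using \<open>card A > 0\<close> card_extendable_pos[of k N]
        by (simp add: ln_mult ln_realpow)
      finally show ?thesis .
    qed
    \<comment> \<open>\<open>D\<close> collects what is independent of \<open>m\<close>: the cost of
      the two borders and the leftover \<open>p 0\<close> from splitting a word of length
      \<open>m * n\<close> into \<open>m\<close> blocks.\<close>
    define D where "D = 2 * real k * ln (real (card A)) + p 0"
    have "real m * (l * real n - p n) \<le> D" for m
    proof -
      have "l * real (m * n) \<le> l * real (k + m * n + k)"
        using l(3) by (intro mult_left_mono) auto
      also have "\<dots> \<le> a (k + m * n + k)" by (rule l(2))
      also have "\<dots> \<le> 2 * real k * ln (real (card A)) + p (m * n)" by (rule a_le)
      also have "p (m * n) \<le> real m * p n + p 0"
        using subadditive_mult_le[of p m n 0, OF psub] by simp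
      finally show ?thesis by (simp add: D_def algebra_simps)
    qed
    \<comment> \<open>A real number all of whose natural multiples stay below a fixed bound cannot
      be positive.\<close>
    then have "l * real n - p n \<le> 0"
      by (meson ex_less_of_nat_mult not_le)
    moreover have "p n \<le> ln (real (complexity subshift n))"
    proof -
      have "card (extendable k n) \<le> complexity subshift n"
        unfolding complexity_def by (rule card_mono[OF finite_factors k])
      then show ?thesis unfolding p_def using card_extendable_pos[of k n] by simp
    qed
    ultimately show ?thesis by simp
  qed
  \<comment> \<open>The case of complexity 0 relies on the default value \<open>ln 0 = 0\<close>,
    which is at most \<open>a n\<close>.\<close>
  have upper: "ln (real (complexity subshift n)) \<le> a n" for n
    using complexity_subshift_le[of n] pos[of n]
    by (cases "complexity subshift n = 0") (auto simp: a_def intro: nonneg)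
  have "(\<lambda>n. ln (real (complexity subshift n)) / real n) \<longlonglongrightarrow> l"
  proof (rule tendsto_sandwich[OF _ _ tendsto_const l(1)])
    \<comment> \<open>At \<open>n = 0\<close> the quotient is 0 by convention and may lie below
      \<open>l\<close>, so the bound is only claimed eventually.\<close>
    show "\<forall>\<^sub>F n in sequentially. l \<le> ln (real (complexity subshift n)) / real n"
      using eventually_gt_at_top[of 0]
      by eventually_elim (use lower in \<open>simp add: field_simps\<close>)
    show "\<forall>\<^sub>F n in sequentially. ln (real (complexity subshift n)) / real n \<le> a n / real n"
      using upper by (intro always_eventually allI divide_right_mono) auto
  qed
  then have "entropy subshift = l" unfolding entropy_def by (rule limI)
  with l(1) show ?thesis using that unfolding a_def by blast
qed

end

section \<open>Self-avoiding words\<close>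

text \<open>These are the edge labels of self-avoiding walks. Such a walk may be trapped, so a word
  in this set need not be a factor of the skeleton.\<close>

definition saw_words :: "('a, 'b) monoid_scheme \<Rightarrow> 'a set \<Rightarrow> 'a list set" where
  "saw_words G S =
     {w \<in> lists S. \<forall>u. sublist u w \<and> u \<noteq> [] \<longrightarrow> word_value G u \<noteq> one G}"

fun visited :: "('a, 'b) monoid_scheme \<Rightarrow> 'a \<Rightarrow> 'a list \<Rightarrow> 'a list" where
  "visited G g [] = [g]"
| "visited G g (s # w) = g # visited G (mult G g s) w"

lemma word_value_Nil [simp]: "word_value G [] = one G"
  by (simp add: word_value_def)

lemma word_value_Cons [simp]: "word_value G (s # w) = mult G s (word_value G w)"
  by (simp add: word_value_def)

lemma length_visited [simp]: "length (visited G g w) = Suc (length w)"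
  by (induction w arbitrary: g) auto

lemma visited_not_Nil [simp]: "visited G g w \<noteq> []"
  by (cases w) auto

lemma Nil_not_visited [simp]: "[] \<noteq> visited G g w"
  using visited_not_Nil by metis

lemma hd_visited [simp]: "hd (visited G g w) = g"
  by (cases w) auto

lemma prefix_in_lists:
  assumes "prefix u w" "w \<in> lists B"
  shows "u \<in> lists B"
  using assms by (auto dest: set_mono_prefix)

lemma factor_imp_factor_sublist:
  assumes "factor w x" and "sublist u w"
  shows "factor u x"
proof -
  obtain i where i: "w = map (\<lambda>k. x (i + int k)) [0..<length w]"
    using assms(1) by (auto simp: factor_def)
  obtain ps ss where w: "w = ps @ u @ ss" using assms(2) by (auto simp: sublist_def)
  have "u = map (\<lambda>k. x (i + int (length ps) + int k)) [0..<length u]"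
  proof (rule nth_equalityI)
    fix p assume "p < length u"
    then have "u ! p = w ! (length ps + p)" "length ps + p < length w"
      by (auto simp: w nth_append)
    moreover from this(2) have "w ! (length ps + p) = x (i + int (length ps + p))"
      by (subst i) simp
    ultimately show "u ! p = map (\<lambda>k. x (i + int (length ps) + int k)) [0..<length u] ! p"
      using \<open>p < length u\<close> by (simp add: add.assoc)
  qed simp
  then show ?thesis unfolding factor_def by blast
qed

text \<open>Factors of factors are factors, so testing all sublists of a factor adds no condition;
  one-letter factors recover the constraint that every letter lies in \<open>S\<close>.\<close>

lemma skeleton_eq: "skeleton G S = {x. \<forall>w. factor w x \<longrightarrow> w \<in> saw_words G S}"
proof (intro equalityI subsetI)
  fix x assume x: "x \<in> skeleton G S"
  have "w \<in> saw_words G S" if "factor w x" for w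
  proof -
    obtain i where i: "w = map (\<lambda>k. x (i + int k)) [0..<length w]"
      using \<open>factor w x\<close> unfolding factor_def by blast
    have "w \<in> lists S" by (subst i) (use x in \<open>auto simp: skeleton_def\<close>)
    moreover have "word_value G u \<noteq> one G" if "sublist u w" "u \<noteq> []" for u
      using x factor_imp_factor_sublist[OF \<open>factor w x\<close> that(1)] that(2)
      by (auto simp: skeleton_def)
    ultimately show ?thesis by (auto simp: saw_words_def)
  qed
  then show "x \<in> {x. \<forall>w. factor w x \<longrightarrow> w \<in> saw_words G S}" by blast
next
  fix x assume "x \<in> {x. \<forall>w. factor w x \<longrightarrow> w \<in> saw_words G S}"
  then have x: "\<And>w. factor w x \<Longrightarrow> w \<in> saw_words G S" by blast
  have "x i \<in> S" for i
  proof -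
    have "factor [x i] x" unfolding factor_def by (rule exI[of _ i]) simp
    then show ?thesis using x by (fastforce simp: saw_words_def)
  qed
  moreover have "word_value G w \<noteq> one G" if "factor w x" "w \<noteq> []" for w
    using x[OF that(1)] that(2) by (auto simp: saw_words_def)
  ultimately show "x \<in> skeleton G S" by (auto simp: skeleton_def)
qed

section \<open>Words as walks in the Cayley graph\<close>

context group
begin

lemma word_value_closed [simp]:
  "w \<in> lists (carrier G) \<Longrightarrow> word_value G w \<in> carrier G"
  by (induction w) auto

lemma word_value_append:
  "u \<in> lists (carrier G) \<Longrightarrow> v \<in> lists (carrier G) \<Longrightarrow>
   word_value G (u @ v) = word_value G u \<otimes> word_value G v"
  by (induction u) (auto simp: m_assoc)

lemma set_visited:
  assumes "g \<in> carrier G" "w \<in> lists (carrier G)"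
  shows "set (visited G g w) = {g \<otimes> word_value G u | u. prefix u w}"
  using assms
proof (induction w arbitrary: g)
  case (Cons s w)
  have assoc: "g \<otimes> (s \<otimes> word_value G u) = g \<otimes> s \<otimes> word_value G u" if "prefix u w" for u
    using that Cons.prems by (simp add: m_assoc prefix_in_lists)
  have "{u. prefix u (s # w)} = insert [] ((#) s ` {u. prefix u w})"
    by (auto simp: prefix_Cons)
  then have "{g \<otimes> word_value G u | u. prefix u (s # w)} =
      insert g {g \<otimes> s \<otimes> word_value G u | u. prefix u w}"
    using Cons.prems by (simp add: setcompr_eq_image image_image assoc cong: image_cong_simp)
  then show ?case using Cons by simp
qed simp

text \<open>By cancellation, two visits to one vertex enclose a factor of trivial value. In the
  induction, a return to the first vertex corresponds to a nonempty trivial prefix, and the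
  remaining factors of \<open>s # w\<close> are factors of \<open>w\<close>.\<close>

lemma distinct_visited_iff:
  assumes "g \<in> carrier G" "w \<in> lists (carrier G)"
  shows "distinct (visited G g w) \<longleftrightarrow>
    (\<forall>u. sublist u w \<and> u \<noteq> [] \<longrightarrow> word_value G u \<noteq> \<one>)"
  using assms
proof (induction w arbitrary: g)
  case (Cons s w)
  have "g \<in> set (visited G (g \<otimes> s) w) \<longleftrightarrow> (\<exists>u. prefix u w \<and> s \<otimes> word_value G u = \<one>)"
  proof -
    have "g = g \<otimes> s \<otimes> word_value G u \<longleftrightarrow> s \<otimes> word_value G u = \<one>" if "prefix u w" for u
    proof -
      have "word_value G u \<in> carrier G"
        using that Cons.prems by (simp add: prefix_in_lists)
      then show ?thesis using Cons.prems by (simp add: m_assoc)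
    qed
    then show ?thesis using set_visited[of "g \<otimes> s" w] Cons.prems by auto
  qed
  also have "\<dots> \<longleftrightarrow> (\<exists>u. prefix u (s # w) \<and> u \<noteq> [] \<and> word_value G u = \<one>)"
    by (auto simp: prefix_Cons)
  finally show ?case using Cons by (auto simp: sublist_Cons_right)
qed simp

text \<open>Consecutive vertices determine the letter between them by left cancellation.\<close>

lemma inj_on_visited: "inj_on (visited G g) (lists (carrier G))" if "g \<in> carrier G"
proof (rule inj_onI)
  fix u v assume "u \<in> lists (carrier G)" "v \<in> lists (carrier G)" "visited G g u = visited G g v"
  then show "u = v" using that
  proof (induction u arbitrary: g v rule: list.induct)
    case Nil then show ?case by (cases v) auto
  next
    case (Cons s u)
    then obtain t v' where v: "v = t # v'" by (cases v) auto
    have eq: "visited G (g \<otimes> s) u = visited G (g \<otimes> t) v'" using Cons.prems v by simp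
    then have "g \<otimes> s = g \<otimes> t" by (metis hd_visited)
    moreover have "s \<in> carrier G" "t \<in> carrier G" using Cons.prems v by auto
    ultimately have "s = t" using Cons.prems(4) by simp
    then show ?case using Cons v eq by simp
  qed
qed

lemma arcs_ends_cayley_graph:
  "arcs_ends (cayley_graph G S) = {(g, g \<otimes> s) | g s. g \<in> carrier G \<and> s \<in> S}"
  by (auto simp: arcs_ends_conv cayley_graph_def image_iff)

lemma vwalk_visited:
  assumes "g \<in> carrier G" "w \<in> lists S" "S \<subseteq> carrier G"
  shows "vwalk (visited G g w) (cayley_graph G S)"
  using assms
proof (induction w arbitrary: g)
  case Nil then show ?case by (auto simp: vwalk_def cayley_graph_def)
next
  case (Cons s w)
  then have "vwalk (visited G (g \<otimes> s) w) (cayley_graph G S)" by auto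
  then show ?case using Cons.prems
    by (auto intro!: vwalk_consI simp: arcs_ends_cayley_graph) (auto simp: cayley_graph_def)
qed

lemma vwalk_cayley_graph_imp_visited:
  assumes "vwalk p (cayley_graph G S)"
  shows "\<exists>w\<in>lists S. p = visited G (hd p) w"
  using assms
proof (induction p rule: vwalk_induct)
  case (Base u) show ?case by (intro bexI[of _ "[]"]) auto
next
  case (Cons u v es)
  then obtain s w where "s \<in> S" "v = u \<otimes> s" "w \<in> lists S" "v # es = visited G v w"
    by (auto simp: arcs_ends_cayley_graph)
  then show ?case by (intro bexI[of _ "s # w"]) auto
qed

text \<open>\<open>visited\<close> from the identity is a bijection from words to walks; a word of
  length \<open>n\<close> gives \<open>n + 1\<close> vertices, matching the convention for
  \<open>vwalk_length\<close>.\<close>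

lemma saw_count_eq:
  assumes "S \<subseteq> carrier G"
  shows "saw_count (cayley_graph G S) \<one> n = card {w \<in> saw_words G S. length w = n}"
proof -
  have sub: "lists S \<subseteq> lists (carrier G)" using assms by (rule lists_mono)
  have "{p. vpath p (cayley_graph G S) \<and> hd p = \<one> \<and> vwalk_length p = n} =
      visited G \<one> ` {w \<in> saw_words G S. length w = n}" (is "?P = ?T")
  proof (intro equalityI subsetI)
    fix p assume "p \<in> ?P"
    then have p: "vwalk p (cayley_graph G S)" "distinct p" "hd p = \<one>" "length p - 1 = n"
      by (auto simp: vpath_def)
    then obtain w where w: "w \<in> lists S" "p = visited G \<one> w"
      using vwalk_cayley_graph_imp_visited by metis
    then have "w \<in> saw_words G S"
      using p(2) sub distinct_visited_iff[of \<one> w] by (auto simp: saw_words_def)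
    then show "p \<in> ?T" using w p by auto
  next
    fix p assume "p \<in> ?T"
    then obtain w where w: "w \<in> saw_words G S" "length w = n" "p = visited G \<one> w" by blast
    have "w \<in> lists S" using w by (simp add: saw_words_def)
    then show "p \<in> ?P"
      using w sub vwalk_visited[of \<one> w S] assms distinct_visited_iff[of \<one> w]
      by (auto simp: saw_words_def vpath_def)
  qed
  moreover have "inj_on (visited G \<one>) {w \<in> saw_words G S. length w = n}"
    by (rule inj_on_subset[OF inj_on_visited]) (use sub in \<open>auto simp: saw_words_def\<close>)
  ultimately show ?thesis unfolding saw_count_def by (simp add: card_image)
qed

section \<open>Self-avoiding words of every length\<close>

lemma generate_word:
  assumes "S \<subseteq> carrier G" "(\<lambda>s. inv s) ` S = S" "g \<in> generate G S"
  shows "\<exists>w\<in>lists S. word_value G w = g"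
  using assms(3)
proof (induction rule: generate.induct)
  case one show ?case by (intro bexI[of _ "[]"]) auto
next
  case (incl h) then show ?case using assms(1) by (intro bexI[of _ "[h]"]) auto
next
  case (inv h)
  \<comment> \<open>Symmetry of \<open>S\<close> lets a single letter represent an inverse
    generator.\<close>
  then have "inv h \<in> S" using assms(2) by blast
  then show ?case using assms(1) by (intro bexI[of _ "[inv h]"]) auto
next
  case (eng g h)
  then obtain u v where "u \<in> lists S" "v \<in> lists S" "word_value G u = g" "word_value G v = h"
    by blast
  then show ?case using assms(1) lists_mono[OF assms(1)] word_value_append[of u v]
    by (intro bexI[of _ "u @ v"]) auto
qed

text \<open>Deleting a nonempty factor of trivial value would leave a shorter word with the same
  value.\<close>

lemma shortest_word_in_saw_words:
  assumes "S \<subseteq> carrier G" "w \<in> lists S"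
    and shortest: "\<And>v. v \<in> lists S \<Longrightarrow> word_value G v = word_value G w \<Longrightarrow> length w \<le> length v"
  shows "w \<in> saw_words G S"
proof -
  have "word_value G u \<noteq> \<one>" if u: "sublist u w" "u \<noteq> []" for u
  proof
    assume one: "word_value G u = \<one>"
    obtain ps ss where w: "w = ps @ u @ ss" using u by (auto simp: sublist_def)
    then have "ps \<in> lists (carrier G)" "u \<in> lists (carrier G)" "ss \<in> lists (carrier G)"
      using assms(1,2) by auto
    then have "word_value G w = word_value G (ps @ ss)"
      by (simp add: w word_value_append one)
    then show False using shortest[of "ps @ ss"] assms(2) w u(2) by auto
  qed
  then show ?thesis using assms(2) by (auto simp: saw_words_def)
qed

lemma saw_words_sublist:
  assumes "w \<in> saw_words G S" "sublist u w"
  shows "u \<in> saw_words G S"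
  using assms unfolding saw_words_def
  by (auto dest: set_mono_sublist intro: sublist_order.order.trans)

text \<open>Words of length at most \<open>n\<close> reach only finitely many elements. A shortest
  word for an element beyond them is self-avoiding and longer than \<open>n\<close>, and its prefix
  of length \<open>n\<close> inherits this property.\<close>

lemma saw_words_all_lengths:
  assumes "infinite (carrier G)" "finite S" "S \<subseteq> carrier G"
    and "generate G S = carrier G" "(\<lambda>s. inv s) ` S = S"
  shows "\<exists>w\<in>saw_words G S. length w = n"
proof -
  have "finite (word_value G ` {w. set w \<subseteq> S \<and> length w \<le> n})"
    using finite_lists_length_le[OF assms(2)] by blast
  then obtain g where g: "g \<in> carrier G" "g \<notin> word_value G ` {w. set w \<subseteq> S \<and> length w \<le> n}"
    using assms(1) by (metis finite_subset subsetI)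
  let ?P = "\<lambda>w. w \<in> lists S \<and> word_value G w = g"
  have "\<exists>w. ?P w" using generate_word[of S g] assms g by auto
  then obtain w where w: "?P w" "\<And>v. ?P v \<Longrightarrow> length w \<le> length v"
    using ex_has_least_nat[of ?P _ length] by blast
  have "w \<in> saw_words G S" using shortest_word_in_saw_words[of S w] w assms(3) by blast
  then have "take n w \<in> saw_words G S" by (rule saw_words_sublist) simp
  moreover have "length (take n w) = n" using g w(1) by force
  ultimately show ?thesis by blast
qed

end

theorem lemma3p4:
  fixes G (structure) and S
  assumes "group G"
    and "infinite (carrier G)"
    and "finite S"
    and "S \<subseteq> carrier G"
    and "generate G S = carrier G"
    and "(\<lambda>s. inv s) ` S = S"
    and "\<one> \<notin> S"
  shows "entropy (skeleton G S) = ln (connective_constant G S)"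
proof -
  interpret group G by fact
  interpret factorial_language S "saw_words G S"
  proof
    show "saw_words G S \<subseteq> lists S" by (auto simp: saw_words_def)
    show "\<exists>w\<in>saw_words G S. length w = n" for n using saw_words_all_lengths assms by blast
  qed (use assms saw_words_sublist in auto)
  let ?c = "\<lambda>n. card {w \<in> saw_words G S. length w = n}"
  obtain l where l: "(\<lambda>n. ln (real (?c n)) / real n) \<longlonglongrightarrow> l" "entropy subshift = l"
    by (rule entropy_subshift)
  have "(\<lambda>n. exp (ln (real (?c n)) / real n)) \<longlonglongrightarrow> exp l"
    using l(1) by (rule tendsto_exp)
  \<comment> \<open>The index 0 is excluded because the two sides differ there:
    \<open>root 0\<close> is 0 by convention, while the exponential of a quotient by 0 is 1.\<close>
  moreover have "\<forall>\<^sub>F n in sequentially. exp (ln (real (?c n)) / real n) = root n (real (?c n))"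
    using eventually_gt_at_top[of 0]
  proof eventually_elim
    case (elim n)
    have "?c n > 0" using card_extendable_pos[of 0 n] by (simp add: extendable_0)
    then have "exp (ln (real (?c n)) / real n) = exp (ln (root n (real (?c n))))"
      using elim by (simp add: ln_root)
    also have "\<dots> = root n (real (?c n))"
      using elim \<open>?c n > 0\<close> by (intro exp_ln real_root_gt_zero) auto
    finally show ?case .
  qed
  ultimately have "(\<lambda>n. root n (real (?c n))) \<longlonglongrightarrow> exp l"
    by (rule Lim_transform_eventually)
  then have "connective_constant G S = exp l"
    unfolding connective_constant_def saw_count_eq[OF assms(4)] by (rule limI)
  moreover have "skeleton G S = subshift" by (simp add: skeleton_eq subshift_def)
  ultimately show ?thesis using l(2) by simp
qed

end
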